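(* Let $H$ be a real Hilbert space, $C\subset H$ a non-empty closed convex set with metric projection $P_C\colon H\to C$, and let $J_\bullet=(J_\lambda)_{\lambda\ge0}$ be a family of maps $J_\lambda\colon H\to H$. The following are equivalent: (i) $J_\bullet$ is a strongly continuous non-expansive non-linear resolvent on $C$; (ii) the graph limit $$A=\operatorname{Gph\text{-}lim}_{\lambda\downarrow0}\tfrac1\lambda(I_H-J_\lambda)$$ exists and is a maximal monotone operator with $\overline{D(A)}=C$, $J_\lambda=(I_H+\lambda A)^{-1}$ for every $\lambda>0$, and $J_0=P_C$.
   Context: A multivalued operator $A\colon H\rightrightarrows H$ is a map $A\colon H\to2^H$ with $D(A)=\{f:A(f)\ne\emptyset\}$ and graph $\{(f,g):g\in A(f)\}\subset H\times H$. It is monotone if $\langle g_1-g_2|f_1-f_2\rangle\ge0$ whenever $g_i\in A(f_i)$, and maximal monotone if it is monotone and maximal with respect to inclusion of graphs. $J_\bullet$ is a strongly continuous non-expansive non-linear resolvent on $C$ if: $J_0=P_C$; $J_\lambda=J_\mu\circ\big(\tfrac\mu\lambda I_H+(1-\tfrac\mu\lambda)J_\lambda\big)$ for all $\lambda>0$, $\mu\ge0$; $\lim_{\lambda\to0}\|J_\lambda(f)-P_C(f)\|=0$ for all $f\in H$; and $\|J_\lambda(f)-J_\lambda(g)\|\le\|f-g\|$ for all $f,g\in H$, $\lambda\ge0$. Graph convergence: for a metric space $(Z,d)$ and subsets $G_\lambda$, the outer limit as $\lambda\downarrow0$ is $\{z:\liminf_{\lambda\downarrow0} d(z,G_\lambda)=0\}$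 and the inner limit is $\{z:\limsup_{\lambda\downarrow0} d(z,G_\lambda)=0\}$; the family converges in the Painlevé–Kuratowski sense if the two coincide, the common set being the limit. $\operatorname{Gph\text{-}lim}_{\lambda\downarrow0}A_\lambda=A$ means that the graphs of $A_\lambda$ converge in this sense to the graph of $A$ in $H\times H$. *)

theory Defs
  imports "HOL-Analysis.Analysis"
begin

text \<open>
  The library constant \<^const>\<open>closest_point\<close> carries the sort \<^class>\<open>heine_borel\<close> and so only covers
  finite-dimensional spaces. The nearest point below exists and is unique when \<open>C\<close> is a non-empty
  closed convex subset of a real Hilbert space, rendered as a type of sort
  \<open>{real_inner, complete_space}\<close>.
\<close>

definition metric_proj :: "'a::real_inner set \<Rightarrow> 'a \<Rightarrow> 'a" where
  "metric_proj C f = (THE p. p \<in> C \<and> (\<forall>q\<in>C. dist f p \<le> dist f q))"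

type_synonym 'a mv_op = "'a \<Rightarrow> 'a set"

definition mv_dom :: "'a mv_op \<Rightarrow> 'a set" where
  "mv_dom A = {f. A f \<noteq> {}}"

definition mv_graph :: "'a mv_op \<Rightarrow> ('a \<times> 'a) set" where
  "mv_graph A = {(f, g). g \<in> A f}"

definition mv_of :: "('a \<Rightarrow> 'a) \<Rightarrow> 'a mv_op" where
  "mv_of T = (\<lambda>f. {T f})"

definition mv_inverse :: "'a mv_op \<Rightarrow> 'a mv_op" where
  "mv_inverse A = (\<lambda>g. {f. g \<in> A f})"

definition id_plus :: "real \<Rightarrow> 'a::real_vector mv_op \<Rightarrow> 'a mv_op" where
  "id_plus l A = (\<lambda>f. {f + l *\<^sub>R g | g. g \<in> A f})"

definition mv_monotone :: "'a::real_inner mv_op \<Rightarrow> bool" where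
  "mv_monotone A \<longleftrightarrow>
     (\<forall>f1 f2 g1 g2. g1 \<in> A f1 \<longrightarrow> g2 \<in> A f2 \<longrightarrow> inner (g1 - g2) (f1 - f2) \<ge> 0)"

definition mv_maximal_monotone :: "'a::real_inner mv_op \<Rightarrow> bool" where
  "mv_maximal_monotone A \<longleftrightarrow>
     mv_monotone A \<and>
     (\<forall>B. mv_monotone B \<longrightarrow> mv_graph A \<subseteq> mv_graph B \<longrightarrow> mv_graph B = mv_graph A)"

text \<open>
  Painleve--Kuratowski limits as \<open>\<lambda> \<down> 0\<close>. The distance to a set is taken in \<^typ>\<open>ereal\<close>, so that the
  distance to the empty set is \<open>\<infinity>\<close>; the library's \<^const>\<open>infdist\<close> would give \<open>0\<close>.
\<close>

definition set_distance :: "'z::metric_space \<Rightarrow> 'z set \<Rightarrow> ereal" where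
  "set_distance z G = (INF y\<in>G. ereal (dist z y))"

definition outer_limit :: "(real \<Rightarrow> 'z::metric_space set) \<Rightarrow> 'z set" where
  "outer_limit G = {z. Liminf (at_right 0) (\<lambda>l. set_distance z (G l)) = 0}"

definition inner_limit :: "(real \<Rightarrow> 'z::metric_space set) \<Rightarrow> 'z set" where
  "inner_limit G = {z. Limsup (at_right 0) (\<lambda>l. set_distance z (G l)) = 0}"

definition has_PK_limit :: "(real \<Rightarrow> 'z::metric_space set) \<Rightarrow> 'z set \<Rightarrow> bool" where
  "has_PK_limit G S \<longleftrightarrow> outer_limit G = inner_limit G \<and> outer_limit G = S"

definition has_graph_limit :: "(real \<Rightarrow> 'a::metric_space mv_op) \<Rightarrow> 'a mv_op \<Rightarrow> bool" where
  "has_graph_limit A' A \<longleftrightarrow> has_PK_limit (\<lambda>l. mv_graph (A' l)) (mv_graph A)"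

text \<open>
  A family indexed by \<open>\<lambda> \<ge> 0\<close> is encoded as a function on all of \<^typ>\<open>real\<close>; its values at negative
  arguments are never constrained. The case \<open>m = 0\<close> of the resolvent identity says \<open>J\<^sub>l = J\<^sub>0 \<circ> J\<^sub>l\<close>.
\<close>

definition nonexpansive_resolvent_on ::
  "(real \<Rightarrow> 'a \<Rightarrow> 'a) \<Rightarrow> 'a::real_inner set \<Rightarrow> bool" where
  "nonexpansive_resolvent_on J C \<longleftrightarrow>
     J 0 = metric_proj C \<and>
     (\<forall>l>0. \<forall>m\<ge>0. J l = J m \<circ> (\<lambda>f. (m / l) *\<^sub>R f + (1 - m / l) *\<^sub>R J l f)) \<and>
     (\<forall>f. ((\<lambda>l. norm (J l f - metric_proj C f)) \<longlongrightarrow> 0) (at_right 0)) \<and>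
     (\<forall>l\<ge>0. \<forall>f g. norm (J l f - J l g) \<le> norm (f - g))"

end

theory Submission
  imports Defs
begin

text \<open>
  The resolvent identity says precisely that the relation \<open>J\<^sub>l (u + l g) = u\<close> between \<open>u\<close> and \<open>g\<close>
  does not depend on \<open>l > 0\<close>. This relation is the operator \<open>A\<close>. Non-expansiveness for all small
  \<open>l\<close> is monotonicity of \<open>A\<close>, and surjectivity of \<open>I + A\<close> gives maximality. A pair \<open>(u, g)\<close> in the
  graph of \<open>A\<close> is the limit of the points \<open>(u + l g, g)\<close> of the graphs of the Yosida approximations;
  conversely \<open>(f, g)\<close> in the graph of the \<open>l\<close>-th approximation yields \<open>(f - l g, g)\<close> in the graph of
  \<open>A\<close>, which is closed.

  For the strong convergence \<open>J\<^sub>l f \<longrightarrow> p = P\<^sub>C f\<close>, no weak compactness is needed: the projection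
  inequality \<open>\<langle>f - p, J\<^sub>l f - p\<rangle> \<le> 0\<close> together with monotonicity against a single pair \<open>(v, w)\<close> of
  the graph of \<open>A\<close>, with \<open>v\<close> close to \<open>p\<close>, bounds \<open>\<parallel>J\<^sub>l f - p\<parallel>\<close>.
\<close>

section \<open>Metric projection\<close>

text \<open>Cantor's intersection theorem: the sets \<open>S n\<close> of near-minimisers are
  closed, non-empty and nested, and the parallelogram law shrinks their diameters to 0, so
  completeness supplies a common point.\<close>

lemma nearest_point_exists:
  fixes C :: "'a::{real_inner, complete_space} set"
  assumes "C \<noteq> {}" "closed C" "convex C"
  shows "\<exists>p\<in>C. \<forall>q\<in>C. dist f p \<le> dist f q"
proof -
  define d where "d = infdist f C"
  \<comment> \<open>The slack is put on the squared distance, so that the parallelogram identity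
    bounds squared diameters directly.\<close>
  define S where "S = (\<lambda>n. C \<inter> {x. (dist f x)\<^sup>2 \<le> d\<^sup>2 + inverse (real (Suc n))})"
  have d0: "0 \<le> d" by (simp add: d_def infdist_nonneg)
  have dle: "d \<le> dist f q" if "q \<in> C" for q
    using that by (simp add: d_def infdist_le)
  have "closed (S n)" for n
    unfolding S_def by (intro closed_Int assms closed_Collect_le continuous_intros)
  moreover have "S n \<noteq> {}" for n
  proof -
    have "d < sqrt (d\<^sup>2 + inverse (real (Suc n)))"
      by (intro real_less_rsqrt) simp
    then obtain q where q: "q \<in> C" "dist f q < sqrt (d\<^sup>2 + inverse (real (Suc n)))"
      using assms(1) cINF_less_iff[of C "dist f"]
      by (auto simp: d_def infdist_notempty)
    have "(dist f q)\<^sup>2 \<le> (sqrt (d\<^sup>2 + inverse (real (Suc n))))\<^sup>2"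
      using q(2) by (intro power_mono) auto
    then show ?thesis using q(1) by (auto simp: S_def)
  qed
  moreover have "S n \<subseteq> S m" if "m \<le> n" for m n
  proof -
    have "inverse (real (Suc n)) \<le> inverse (real (Suc m))"
      using that by (intro le_imp_inverse_le) auto
    then show ?thesis
      unfolding S_def by (intro Int_mono Collect_mono impI subset_refl) linarith
  qed
  moreover have "\<exists>n. \<forall>x\<in>S n. \<forall>y\<in>S n. dist x y < e" if "e > 0" for e
  proof -
    have "0 < e\<^sup>2 / 4" using that by simp
    then obtain n where n: "inverse (real (Suc n)) < e\<^sup>2 / 4"
      using reals_Archimedean by blast
    have "dist x y < e" if "x \<in> S n" "y \<in> S n" for x y
    proof -
      \<comment> \<open>By convexity the midpoint is in \<open>C\<close>, hence at distance at least
        \<open>d\<close> from \<open>f\<close>.\<close>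
      define m where "m = (1/2) *\<^sub>R x + (1/2) *\<^sub>R y"
      have "m \<in> C"
        unfolding m_def using that by (intro convexD[OF assms(3)]) (auto simp: S_def)
      then have "d\<^sup>2 \<le> (dist f m)\<^sup>2"
        using dle d0 by (intro power_mono) auto
      moreover have "(dist x y)\<^sup>2 = 2 * (dist f x)\<^sup>2 + 2 * (dist f y)\<^sup>2 - 4 * (dist f m)\<^sup>2"
        by (simp add: m_def dist_norm power2_norm_eq_inner inner_diff_left inner_diff_right
            inner_add_left inner_add_right inner_commute algebra_simps)
      ultimately have "(dist x y)\<^sup>2 \<le> 4 * inverse (real (Suc n))"
        using that by (auto simp: S_def)
      with n have "(dist x y)\<^sup>2 < e\<^sup>2" by linarith
      then show ?thesis using \<open>e > 0\<close> by (auto intro: power_less_imp_less_base)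
    qed
    then show ?thesis by blast
  qed
  ultimately obtain p where p: "\<And>n. p \<in> S n"
    using decreasing_closed_nest[of S] by blast
  have "(\<lambda>n. d\<^sup>2 + inverse (real (Suc n))) \<longlonglongrightarrow> d\<^sup>2 + 0"
    by (intro tendsto_intros LIMSEQ_inverse_real_of_nat)
  then have "(dist f p)\<^sup>2 \<le> d\<^sup>2"
    using p by (intro tendsto_lowerbound[where F = sequentially and f = "\<lambda>n. d\<^sup>2 + inverse (real (Suc n))"])
      (auto simp: S_def)
  then have "dist f p \<le> d"
    using d0 by (rule power2_le_imp_le)
  then show ?thesis
    using p dle by (force simp: S_def)
qed

lemma metric_proj_nearest:
  fixes C :: "'a::{real_inner, complete_space} set"
  assumes "C \<noteq> {}" "closed C" "convex C"
  shows "metric_proj C f \<in> C \<and> (\<forall>q\<in>C. dist f (metric_proj C f) \<le> dist f q)"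
proof -
  obtain p where p: "p \<in> C \<and> (\<forall>q\<in>C. dist f p \<le> dist f q)"
    using nearest_point_exists[OF assms] by blast
  show ?thesis
    unfolding metric_proj_def
    by (rule theI[of _ p]) (use p any_closest_point_unique[OF assms(3,2)] in blast)+
qed

lemma metric_proj_in:
  fixes C :: "'a::{real_inner, complete_space} set"
  assumes "C \<noteq> {}" "closed C" "convex C"
  shows "metric_proj C f \<in> C"
  using metric_proj_nearest[OF assms] by blast

lemma metric_proj_dot:
  fixes C :: "'a::{real_inner, complete_space} set"
  assumes "C \<noteq> {}" "closed C" "convex C" "q \<in> C"
  shows "inner (f - metric_proj C f) (q - metric_proj C f) \<le> 0"
  using metric_proj_nearest[OF assms(1-3)] assms by (intro any_closest_point_dot[of C]) auto

lemma metric_proj_self: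
  fixes C :: "'a::{real_inner, complete_space} set"
  assumes "C \<noteq> {}" "closed C" "convex C" "f \<in> C"
  shows "metric_proj C f = f"
  using metric_proj_nearest[OF assms(1-3), of f] assms(4) by force

text \<open>Adding the obtuse-angle inequalities at the two projections, each tested against the
  other, gives firm non-expansiveness; Cauchy-Schwarz and division by the distance between them
  finish.\<close>

lemma metric_proj_nonexpansive:
  fixes C :: "'a::{real_inner, complete_space} set"
  assumes "C \<noteq> {}" "closed C" "convex C"
  shows "norm (metric_proj C f - metric_proj C g) \<le> norm (f - g)"
proof (cases "metric_proj C f = metric_proj C g")
  case False
  define p q where "p = metric_proj C f" and "q = metric_proj C g"
  have "inner (f - p) (q - p) \<le> 0" "inner (g - q) (p - q) \<le> 0"
    using assms by (auto simp: p_def q_def intro!: metric_proj_dot metric_proj_in)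
  then have "inner (p - q) (p - q) \<le> inner (f - g) (p - q)"
    by (simp add: inner_diff_left inner_diff_right inner_commute algebra_simps)
  also have "\<dots> \<le> norm (f - g) * norm (p - q)"
    by (rule norm_cauchy_schwarz)
  finally have "norm (p - q) * norm (p - q) \<le> norm (f - g) * norm (p - q)"
    by (simp flip: power2_norm_eq_inner power2_eq_square)
  then show ?thesis
    using False by (simp add: p_def q_def)
qed simp

section \<open>Resolvents and monotone operators\<close>

text \<open>The equation of multivalued operators says at once that the inverse is defined
  everywhere and that it is single-valued; the pointwise form carries both.\<close>

lemma mv_of_eq_resolvent_iff:
  assumes "l > 0"
  shows "mv_of T = mv_inverse (id_plus l A) \<longleftrightarrow> (\<forall>f u. (1 / l) *\<^sub>R (f - u) \<in> A u \<longleftrightarrow> u = T f)"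
proof -
  have "f \<in> id_plus l A u \<longleftrightarrow> (1 / l) *\<^sub>R (f - u) \<in> A u" for f u
  proof
    assume "(1 / l) *\<^sub>R (f - u) \<in> A u"
    moreover have "f = u + l *\<^sub>R ((1 / l) *\<^sub>R (f - u))" using assms by simp
    ultimately show "f \<in> id_plus l A u" unfolding id_plus_def by blast
  qed (use assms in \<open>auto simp: id_plus_def\<close>)
  then show ?thesis
    by (auto simp: mv_of_def mv_inverse_def fun_eq_iff set_eq_iff)
qed

text \<open>One resolvent determines the whole graph: substitute
  \<open>f = u + l *\<^sub>R g\<close> in the pointwise form.\<close>

lemma resolvent_mem_iff:
  assumes "l > 0" "mv_of T = mv_inverse (id_plus l A)"
  shows "g \<in> A u \<longleftrightarrow> T (u + l *\<^sub>R g) = u"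
proof -
  have "(1 / l) *\<^sub>R ((u + l *\<^sub>R g) - u) \<in> A u \<longleftrightarrow> u = T (u + l *\<^sub>R g)"
    using assms mv_of_eq_resolvent_iff by blast
  then show ?thesis using assms(1) by auto
qed

lemma resolvent_yosida_mem:
  assumes "l > 0" "mv_of T = mv_inverse (id_plus l A)"
  shows "(1 / l) *\<^sub>R (f - T f) \<in> A (T f)"
  using assms mv_of_eq_resolvent_iff by blast

text \<open>Split \<open>f - g\<close> as \<open>a + b\<close>, with \<open>a\<close> the difference
  of the resolvent values. Monotonicity makes \<open>inner b a\<close> non-negative, so adding
  \<open>b\<close> cannot shorten \<open>a\<close>.\<close>

lemma resolvent_nonexpansive:
  assumes "mv_monotone A" "l > 0" "mv_of T = mv_inverse (id_plus l A)"
  shows "norm (T f - T g) \<le> norm (f - g)"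
proof -
  define a b where "a = T f - T g" and "b = (f - T f) - (g - T g)"
  have "0 \<le> inner ((1 / l) *\<^sub>R (f - T f) - (1 / l) *\<^sub>R (g - T g)) a"
    using assms(1) resolvent_yosida_mem[OF assms(2,3)]
    unfolding mv_monotone_def a_def by blast
  also have "\<dots> = (1 / l) * inner b a"
    by (simp add: b_def inner_diff_left algebra_simps)
  finally have "0 \<le> inner b a"
    using assms(2) by (simp add: zero_le_divide_iff)
  then have "inner a a \<le> inner (a + b) (a + b)"
    by (simp add: inner_add_left inner_add_right inner_commute)
  then show ?thesis
    by (simp add: a_def b_def norm_le)
qed

text \<open>Squaring \<open>norm a \<le> norm (a + l *\<^sub>R b)\<close> and dividing by
  \<open>l\<close> leaves an error term \<open>l * inner b b\<close>, which vanishes as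
  \<open>l\<close> tends to 0.\<close>

lemma mv_monotone_if_resolvents_nonexpansive:
  assumes "\<And>l. l > 0 \<Longrightarrow> mv_of (J l) = mv_inverse (id_plus l A)"
    and "\<And>l f g. l > 0 \<Longrightarrow> norm (J l f - J l g) \<le> norm (f - g)"
  shows "mv_monotone A"
  unfolding mv_monotone_def
proof (intro allI impI)
  fix f1 f2 g1 g2
  assume g: "g1 \<in> A f1" "g2 \<in> A f2"
  define a b where "a = f1 - f2" and "b = g1 - g2"
  have "0 \<le> 2 * inner b a + l * inner b b" if "l > 0" for l
  proof -
    have "norm a \<le> norm (a + l *\<^sub>R b)"
      using assms(2)[OF that, of "f1 + l *\<^sub>R g1" "f2 + l *\<^sub>R g2"]
        resolvent_mem_iff[OF that assms(1)[OF that]] g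
      by (simp add: a_def b_def algebra_simps)
    then have "0 \<le> l * (2 * inner b a + l * inner b b)"
      by (simp add: norm_le inner_add_left inner_add_right inner_commute algebra_simps)
    then show ?thesis using that by (simp add: zero_le_mult_iff)
  qed
  then have "\<forall>\<^sub>F l in at_right 0. 0 \<le> 2 * inner b a + l * inner b b"
    by (rule eventually_mono[OF eventually_at_right_less])
  moreover have "((\<lambda>l. 2 * inner b a + l * inner b b) \<longlongrightarrow> 2 * inner b a + 0 * inner b b) (at_right 0)"
    by (intro tendsto_intros)
  ultimately have "0 \<le> 2 * inner b a + 0 * inner b b"
    by (intro tendsto_lowerbound) auto
  then show "0 \<le> inner (g1 - g2) (f1 - f2)"
    by (simp add: a_def b_def)
qed

text \<open>The easy half of Minty's theorem: by surjectivity of \<open>id_plus l A\<close>, a pair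
  \<open>(u, g)\<close> of a monotone extension can be compared with a pair \<open>(v, w)\<close> of
  \<open>A\<close> having \<open>v + l *\<^sub>R w = u + l *\<^sub>R g\<close>.\<close>

lemma mv_maximal_monotone_if_resolvent:
  assumes "mv_monotone A" "l > 0" "mv_of T = mv_inverse (id_plus l A)"
  shows "mv_maximal_monotone A"
  unfolding mv_maximal_monotone_def
proof (intro conjI allI impI assms(1) equalityI)
  fix B :: "'a mv_op"
  assume B: "mv_monotone B" and sub: "mv_graph A \<subseteq> mv_graph B"
  have "g \<in> A u" if "g \<in> B u" for u g
  proof -
    define v w where "v = T (u + l *\<^sub>R g)" and "w = (1 / l) *\<^sub>R (u + l *\<^sub>R g - v)"
    have w: "w \<in> A v"
      unfolding v_def w_def by (rule resolvent_yosida_mem[OF assms(2,3)])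
    then have "w \<in> B v" using sub by (auto simp: mv_graph_def)
    then have "0 \<le> inner (g - w) (u - v)"
      using B that unfolding mv_monotone_def by blast
    \<comment> \<open>The difference \<open>g - w\<close> is a negative multiple of
      \<open>u - v\<close>, so monotonicity of \<open>B\<close> forces \<open>u = v\<close>.\<close>
    moreover have gw: "g - w = - (1 / l) *\<^sub>R (u - v)"
      using assms(2) by (simp add: w_def algebra_simps)
    ultimately have "inner (u - v) (u - v) \<le> 0"
      using assms(2) by (simp add: divide_le_0_iff)
    then have "inner (u - v) (u - v) = 0" by (intro antisym) auto
    then have "u = v" by simp
    with gw w show ?thesis by simp
  qed
  then show "mv_graph B \<subseteq> mv_graph A" by (auto simp: mv_graph_def)
qed

text \<open>The graph is the set where two continuous maps agree.\<close>

lemma closed_graph_if_resolvent: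
  fixes T :: "'a::real_inner \<Rightarrow> 'a"
  assumes "mv_monotone A" "l > 0" "mv_of T = mv_inverse (id_plus l A)"
  shows "closed (mv_graph A)"
proof -
  have T: "continuous_on UNIV T"
    using resolvent_nonexpansive[OF assms]
    by (intro lipschitz_on_continuous_on[of 1] lipschitz_onI) (auto simp: dist_norm)
  have "mv_graph A = {z. T (fst z + l *\<^sub>R snd z) = fst z}"
    using resolvent_mem_iff[OF assms(2,3)] by (auto simp: mv_graph_def)
  then show ?thesis
    by (auto intro!: closed_Collect_eq continuous_intros continuous_on_compose2[OF T])
qed

lemma resolvent_strong_limit:
  fixes C :: "'a::{real_inner, complete_space} set"
  assumes "C \<noteq> {}" "closed C" "convex C"
    and A: "mv_monotone A" and C: "closure (mv_dom A) = C"
    and J: "\<And>l. l > 0 \<Longrightarrow> mv_of (J l) = mv_inverse (id_plus l A)"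
  shows "((\<lambda>l. norm (J l f - metric_proj C f)) \<longlongrightarrow> 0) (at_right 0)"
proof -
  define p where "p = metric_proj C f"
  \<comment> \<open>For fixed \<open>(v, w)\<close> the right side tends, as \<open>l\<close> goes
    to 0, to a quantity that is small when \<open>v\<close> is near \<open>p\<close>. So
    \<open>v\<close> is chosen first, then \<open>l\<close>.\<close>
  have bound: "(norm (J l f - p))\<^sup>2 \<le> (norm (v - p) + l * norm w)\<^sup>2
      + 2 * (norm (f - p) * norm (v - p) + l * norm w * norm (v - p))"
    if l: "l > 0" and w: "w \<in> A v" for l v w
  proof -
    define d e where "d = J l f - p" and "e = v - p"
    define a where "a = norm e + l * norm w"
    have mem: "(1 / l) *\<^sub>R (f - J l f) \<in> A (J l f)"
      by (rule resolvent_yosida_mem[OF l J[OF l]])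
    then have "J l f \<in> C"
      using C closure_subset by (fastforce simp: mv_dom_def)
    then have proj: "inner (f - p) d \<le> 0"
      using metric_proj_dot[OF assms(1-3)] by (simp add: p_def d_def)
    have "0 \<le> inner ((1 / l) *\<^sub>R (f - J l f) - w) (J l f - v)"
      using A mem w unfolding mv_monotone_def by blast
    also have "(1 / l) *\<^sub>R (f - J l f) - w = (1 / l) *\<^sub>R ((f - p) - d - l *\<^sub>R w)"
      using l by (simp add: d_def algebra_simps)
    finally have "0 \<le> inner ((f - p) - d - l *\<^sub>R w) (J l f - v)"
      using l by (simp add: zero_le_divide_iff)
    moreover have "J l f - v = d - e" by (simp add: d_def e_def)
    ultimately have "inner d d \<le> inner d e + inner (f - p) d - inner (f - p) e
        - l * inner w d + l * inner w e"
      by (simp add: inner_diff_left inner_diff_right inner_commute algebra_simps)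
    also have "\<dots> \<le> norm d * norm e + 0 + norm (f - p) * norm e
        + l * (norm w * norm d) + l * (norm w * norm e)"
    proof -
      have "inner d e \<le> norm d * norm e" by (rule norm_cauchy_schwarz)
      moreover have "- inner (f - p) e \<le> norm (f - p) * norm e"
        using norm_cauchy_schwarz[of "f - p" "- e"] by simp
      moreover have "l * (- inner w d) \<le> l * (norm w * norm d)"
        using l norm_cauchy_schwarz[of w "- d"] by (intro mult_left_mono) auto
      moreover have "l * inner w e \<le> l * (norm w * norm e)"
        using l norm_cauchy_schwarz by (intro mult_left_mono) auto
      ultimately show ?thesis using proj by simp
    qed
    finally have "(norm d)\<^sup>2 \<le> norm d * a + (norm (f - p) * norm e + l * norm w * norm e)"
      by (simp add: a_def power2_norm_eq_inner algebra_simps)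
    \<comment> \<open>Young's inequality absorbs the term linear in \<open>norm d\<close> into half
      of the square on the left.\<close>
    moreover have "2 * (norm d * a) \<le> (norm d)\<^sup>2 + a\<^sup>2"
      using sum_squares_bound[of "norm d" a] by (simp add: algebra_simps)
    ultimately have "(norm d)\<^sup>2 \<le> a\<^sup>2 + 2 * (norm (f - p) * norm e + l * norm w * norm e)"
      by argo
    then show ?thesis
      by (simp add: a_def d_def e_def)
  qed
  have "\<forall>\<^sub>F l in at_right 0. dist (norm (J l f - p)) 0 < \<epsilon>" if "\<epsilon> > 0" for \<epsilon> :: real
  proof -
    \<comment> \<open>Here \<open>r\<close> stands for \<open>norm (v - p)\<close>, and the
      expression is the limit of the bound as \<open>l\<close> goes to 0.\<close>
    have "((\<lambda>r. r\<^sup>2 + 2 * (norm (f - p) * r)) \<longlongrightarrow> 0\<^sup>2 + 2 * (norm (f - p) * 0)) (at_right 0)"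
      by (intro tendsto_intros)
    then have "\<forall>\<^sub>F r in at_right 0. r\<^sup>2 + 2 * (norm (f - p) * r) < \<epsilon>\<^sup>2"
      using that by (intro order_tendstoD(2)) auto
    then obtain \<delta> where \<delta>: "\<delta> > 0" "\<And>r. 0 < r \<Longrightarrow> r < \<delta> \<Longrightarrow> r\<^sup>2 + 2 * (norm (f - p) * r) < \<epsilon>\<^sup>2"
      by (auto simp: eventually_at_right_field)
    have "p \<in> closure (mv_dom A)"
      using metric_proj_in[OF assms(1-3)] C by (simp add: p_def)
    then obtain v where v: "v \<in> mv_dom A" "dist v p < \<delta>"
      using \<delta>(1) closure_approachable by blast
    then obtain w where w: "w \<in> A v" by (auto simp: mv_dom_def)
    have v': "(norm (v - p))\<^sup>2 + 2 * (norm (f - p) * norm (v - p)) < \<epsilon>\<^sup>2"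
      \<comment> \<open>The choice of \<delta> covers only positive \<open>r\<close>, so
        \<open>v = p\<close> is treated apart.\<close>
      using \<delta>(2)[of "norm (v - p)"] v(2) that by (cases "v = p") (auto simp: dist_norm)
    have "((\<lambda>l. (norm (v - p) + l * norm w)\<^sup>2
        + 2 * (norm (f - p) * norm (v - p) + l * norm w * norm (v - p))) \<longlongrightarrow>
        (norm (v - p) + 0 * norm w)\<^sup>2
        + 2 * (norm (f - p) * norm (v - p) + 0 * norm w * norm (v - p))) (at_right 0)"
      by (intro tendsto_intros)
    then have "\<forall>\<^sub>F l in at_right 0. (norm (v - p) + l * norm w)\<^sup>2
        + 2 * (norm (f - p) * norm (v - p) + l * norm w * norm (v - p)) < \<epsilon>\<^sup>2"
      using v' by (intro order_tendstoD(2)) auto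
    then show ?thesis
      using eventually_at_right_less[of 0]
    proof eventually_elim
      case (elim l)
      then have "(norm (J l f - p))\<^sup>2 < \<epsilon>\<^sup>2" using bound[OF _ w, of l] by linarith
      then show ?case using that by (auto intro: power_less_imp_less_base)
    qed
  qed
  then show ?thesis unfolding p_def[symmetric] by (rule tendstoI)
qed

section \<open>Graph limits\<close>

lemma set_distance_nonneg: "0 \<le> set_distance z G"
  unfolding set_distance_def by (intro INF_greatest) auto

lemma inner_limit_subset_outer_limit: "inner_limit G \<subseteq> outer_limit G"
proof
  fix z
  assume "z \<in> inner_limit G"
  then have "Limsup (at_right 0) (\<lambda>l. set_distance z (G l)) = 0"
    by (simp add: inner_limit_def)
  moreover have "Liminf (at_right 0) (\<lambda>l. set_distance z (G l))
      \<le> Limsup (at_right 0) (\<lambda>l. set_distance z (G l))"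
    by (intro Liminf_le_Limsup) simp
  moreover have "0 \<le> Liminf (at_right 0) (\<lambda>l. set_distance z (G l))"
    by (intro Liminf_bounded always_eventually) (simp add: set_distance_nonneg)
  ultimately show "z \<in> outer_limit G" by (simp add: outer_limit_def)
qed

lemma inner_limitI:
  assumes "\<forall>\<^sub>F l in at_right 0. y l \<in> G l" "(y \<longlongrightarrow> z) (at_right 0)"
  shows "z \<in> inner_limit G"
proof -
  have "((\<lambda>l. set_distance z (G l)) \<longlongrightarrow> 0) (at_right 0)"
  proof (rule tendsto_sandwich)
    show "\<forall>\<^sub>F l in at_right 0. 0 \<le> set_distance z (G l)"
      by (simp add: set_distance_nonneg)
    show "\<forall>\<^sub>F l in at_right 0. set_distance z (G l) \<le> ereal (dist z (y l))"
      using assms(1) by eventually_elim (auto simp: set_distance_def intro: INF_lower)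
    have "((\<lambda>l. dist z (y l)) \<longlongrightarrow> dist z z) (at_right 0)"
      by (intro tendsto_intros assms(2))
    then show "((\<lambda>l. ereal (dist z (y l))) \<longlongrightarrow> 0) (at_right 0)"
      by (simp add: zero_ereal_def)
  qed simp
  then show ?thesis
    by (simp add: inner_limit_def lim_imp_Limsup)
qed

text \<open>A vanishing lower limit gives near points only for arbitrarily small parameters, hence
  "frequently" and not "eventually".\<close>

lemma outer_limitD:
  assumes "z \<in> outer_limit G" "e > 0"
  shows "\<exists>\<^sub>F l in at_right 0. \<exists>y\<in>G l. dist z y < e"
proof (rule ccontr)
  assume "\<not> ?thesis"
  then have "\<forall>\<^sub>F l in at_right 0. ereal e \<le> set_distance z (G l)"
    unfolding not_frequently
    by (rule eventually_mono) (auto simp: set_distance_def not_less intro!: INF_greatest)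
  then have "ereal e \<le> Liminf (at_right 0) (\<lambda>l. set_distance z (G l))"
    by (rule Liminf_bounded)
  then show False using assms by (simp add: outer_limit_def)
qed

lemma has_graph_limit_yosida:
  fixes J :: "real \<Rightarrow> 'a::real_inner \<Rightarrow> 'a"
  assumes closed: "closed (mv_graph A)"
    and J: "\<And>l. l > 0 \<Longrightarrow> mv_of (J l) = mv_inverse (id_plus l A)"
  shows "has_graph_limit (\<lambda>l. mv_of (\<lambda>f. (1 / l) *\<^sub>R (f - J l f))) A"
proof -
  define G where "G = (\<lambda>l. mv_graph (mv_of (\<lambda>f. (1 / l) *\<^sub>R (f - J l f))))"
  have "mv_graph A \<subseteq> inner_limit G"
  proof
    fix z
    assume "z \<in> mv_graph A"
    then obtain u g where z: "z = (u, g)" and g: "g \<in> A u" by (auto simp: mv_graph_def)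
    have "(u + l *\<^sub>R g, g) \<in> G l" if "l > 0" for l
      using resolvent_mem_iff[OF that J[OF that]] g that by (simp add: G_def mv_graph_def mv_of_def)
    then have "\<forall>\<^sub>F l in at_right 0. (u + l *\<^sub>R g, g) \<in> G l"
      by (rule eventually_mono[OF eventually_at_right_less])
    moreover have "((\<lambda>l. (u + l *\<^sub>R g, g)) \<longlongrightarrow> (u + 0 *\<^sub>R g, g)) (at_right 0)"
      by (intro tendsto_intros)
    ultimately show "z \<in> inner_limit G"
      unfolding z by (intro inner_limitI[where y = "\<lambda>l. (u + l *\<^sub>R g, g)"]) auto
  qed
  moreover have "outer_limit G \<subseteq> mv_graph A"
  proof
    fix z
    assume z: "z \<in> outer_limit G"
    define u g where "u = fst z" and "g = snd z"
    have "\<exists>y\<in>mv_graph A. dist y z < e" if "e > 0" for e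
    proof -
      \<comment> \<open>The cap 1 bounds \<open>norm h\<close> by \<open>norm g + 1\<close> before
        \<open>l\<close> is known. Then \<open>z\<close> to \<open>y\<close> and \<open>y\<close> to
        \<open>(J l f, h)\<close> each cost less than \<delta>.\<close>
      define \<delta> where "\<delta> = min 1 (e / 3)"
      have \<delta>: "0 < \<delta>" "\<delta> \<le> 1" "3 * \<delta> \<le> e" using that by (auto simp: \<delta>_def)
      have "((\<lambda>l. l * (norm g + 1)) \<longlongrightarrow> 0 * (norm g + 1)) (at_right 0)"
        by (intro tendsto_intros)
      then have "\<forall>\<^sub>F l in at_right 0. l * (norm g + 1) < \<delta>"
        using \<delta> by (intro order_tendstoD(2)) auto
      moreover have "\<forall>\<^sub>F l in at_right 0. l > (0::real)"
        by (simp add: eventually_at_right_less)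
      ultimately have "\<exists>\<^sub>F l in at_right 0. (\<exists>y\<in>G l. dist z y < \<delta>) \<and> l * (norm g + 1) < \<delta> \<and> l > 0"
        using outer_limitD[OF z \<delta>(1)]
        by (simp add: frequently_eventually_frequently eventually_conj)
      then obtain l y where l: "l > 0" "l * (norm g + 1) < \<delta>" and y: "y \<in> G l" "dist z y < \<delta>"
        by (auto dest: frequently_ex)
      obtain f where f: "y = (f, (1 / l) *\<^sub>R (f - J l f))"
        using y(1) by (auto simp: G_def mv_graph_def mv_of_def)
      define h where "h = (1 / l) *\<^sub>R (f - J l f)"
      have "h \<in> A (J l f)"
        unfolding h_def using l by (intro resolvent_yosida_mem J)
      then have "(J l f, h) \<in> mv_graph A" by (simp add: mv_graph_def)
      moreover have "dist (J l f, h) z < e"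
      proof -
        have "dist g h \<le> dist z y"
          using dist_snd_le[of z y] by (simp add: g_def f h_def)
        then have gh: "dist g h < 1" using y(2) \<delta> by simp
        then have "norm h \<le> norm g + 1"
          using norm_triangle_sub[of h g] by (simp add: dist_norm norm_minus_commute)
        then have "l * norm h < \<delta>"
          using l mult_left_mono[of "norm h" "norm g + 1" l] by linarith
        moreover have "dist (J l f, h) y = l * norm h"
          using l by (simp add: f h_def dist_Pair_Pair dist_norm norm_minus_commute)
        ultimately show ?thesis
          using dist_triangle[of "(J l f, h)" z y] y(2) \<delta> by (simp add: dist_commute)
      qed
      ultimately show ?thesis by blast
    qed
    then show "z \<in> mv_graph A"
      using closed closure_approachable[of z "mv_graph A"] by (simp add: closure_closed)
  qed
  ultimately show ?thesis
    using inner_limit_subset_outer_limit[of G]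
    unfolding has_graph_limit_def has_PK_limit_def G_def[symmetric] by blast
qed

section \<open>The correspondence\<close>

lemma nonexpansive_resolvent_generator:
  fixes C :: "'a::{real_inner, complete_space} set"
  assumes C: "C \<noteq> {}" "closed C" "convex C"
    and J: "nonexpansive_resolvent_on J C"
  shows "\<exists>A. mv_maximal_monotone A \<and> closed (mv_graph A) \<and> closure (mv_dom A) = C \<and>
    (\<forall>l>0. mv_of (J l) = mv_inverse (id_plus l A))"
proof -
  have J0: "J 0 = metric_proj C"
    and id: "\<And>l m f. l > 0 \<Longrightarrow> m \<ge> 0 \<Longrightarrow> J l f = J m ((m / l) *\<^sub>R f + (1 - m / l) *\<^sub>R J l f)"
    and lim: "\<And>f. ((\<lambda>l. norm (J l f - metric_proj C f)) \<longlongrightarrow> 0) (at_right 0)"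
    and ne: "\<And>l f g. l \<ge> 0 \<Longrightarrow> norm (J l f - J l g) \<le> norm (f - g)"
    using J unfolding nonexpansive_resolvent_on_def comp_def fun_eq_iff by blast+
  \<comment> \<open>When \<open>J l (u + l *\<^sub>R g) = u\<close>, the argument of
    \<open>J m\<close> in the resolvent identity collapses to
    \<open>u + m *\<^sub>R g\<close>.\<close>
  have change: "J m (u + m *\<^sub>R g) = u" if "J l (u + l *\<^sub>R g) = u" "l > 0" "m > 0" for l m u g
    using id[of l m "u + l *\<^sub>R g"] that by (simp add: algebra_simps)
  \<comment> \<open>The parameter 1 is an arbitrary choice, by \<open>change\<close>.\<close>
  define A where "A = (\<lambda>u. {g. J 1 (u + g) = u})"
  have A: "g \<in> A u \<longleftrightarrow> J l (u + l *\<^sub>R g) = u" if "l > 0" for l u g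
    using change[of 1 u g l] change[of l u g 1] that by (auto simp: A_def)
  have res: "mv_of (J l) = mv_inverse (id_plus l A)" if "l > 0" for l
    using that A[OF that] by (auto simp: mv_of_eq_resolvent_iff)
  have mono: "mv_monotone A"
    using mv_monotone_if_resolvents_nonexpansive[OF res] ne by (metis less_imp_le)
  have mem: "J l f \<in> mv_dom A" if "l > 0" for l f
    using resolvent_yosida_mem[OF that res[OF that]] by (auto simp: mv_dom_def)
  have "mv_dom A \<subseteq> C"
  proof
    fix u
    assume "u \<in> mv_dom A"
    then obtain g where "J 1 (u + g) = u" by (auto simp: mv_dom_def A_def)
    \<comment> \<open>The case \<open>m = 0\<close> of the resolvent identity: values of
      \<open>J 1\<close> are fixed by the projection.\<close>
    then have "u = metric_proj C u" using id[of 1 0 "u + g"] by (simp add: J0)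
    then show "u \<in> C" using metric_proj_in[OF C, of u] by simp
  qed
  \<comment> \<open>Density comes from strong continuity: for \<open>f\<close> in \<open>C\<close>,
    the points \<open>J l f\<close> of the domain converge to \<open>f\<close>.\<close>
  moreover have "C \<subseteq> closure (mv_dom A)"
  proof
    fix f
    assume "f \<in> C"
    then have "((\<lambda>l. norm (J l f - f)) \<longlongrightarrow> 0) (at_right 0)"
      using lim[of f] by (simp add: metric_proj_self[OF C])
    then have "((\<lambda>l. J l f) \<longlongrightarrow> f) (at_right 0)"
      by (rule LIM_zero_cancel[OF tendsto_norm_zero_cancel])
    moreover have "\<forall>\<^sub>F l in at_right 0. J l f \<in> closure (mv_dom A)"
      by (rule eventually_mono[OF eventually_at_right_less subsetD[OF closure_subset mem]])
    ultimately show "f \<in> closure (mv_dom A)"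
      by (intro Lim_in_closed_set[where F = "at_right 0"]) auto
  qed
  ultimately have "closure (mv_dom A) = C"
    using C(2) by (simp add: closure_minimal subset_antisym)
  then show ?thesis
    using mv_maximal_monotone_if_resolvent[OF mono _ res, of 1]
      closed_graph_if_resolvent[OF mono _ res, of 1] res by auto
qed

lemma nonexpansive_resolvent_on_resolvents:
  fixes C :: "'a::{real_inner, complete_space} set"
  assumes C: "C \<noteq> {}" "closed C" "convex C"
    and A: "mv_monotone A" "closure (mv_dom A) = C"
    and J: "\<And>l. l > 0 \<Longrightarrow> mv_of (J l) = mv_inverse (id_plus l A)"
    and J0: "J 0 = metric_proj C"
  shows "nonexpansive_resolvent_on J C"
  unfolding nonexpansive_resolvent_on_def
proof (intro conjI allI impI J0 ext)
  fix l m :: real and f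
  assume l: "l > 0" and m: "m \<ge> 0"
  define g where "g = (1 / l) *\<^sub>R (f - J l f)"
  have g: "g \<in> A (J l f)"
    unfolding g_def by (rule resolvent_yosida_mem[OF l J[OF l]])
  \<comment> \<open>This is the resolvent identity rewritten with the Yosida value \<open>g\<close>.
    For positive \<open>m\<close> it is membership of \<open>g\<close> in \<open>A (J l f)\<close>;
    for \<open>m = 0\<close> it says that the projection fixes points of the domain.\<close>
  have "J m (J l f + m *\<^sub>R g) = J l f"
  proof (cases "m = 0")
    case True
    have "J l f \<in> C" using g A(2) closure_subset by (fastforce simp: mv_dom_def)
    with True show ?thesis by (simp add: J0 metric_proj_self[OF C])
  next
    case False
    then show ?thesis using resolvent_mem_iff[of m "J m" A] J[of m] g m by simp
  qed
  then show "J l f = (J m \<circ> (\<lambda>f. (m / l) *\<^sub>R f + (1 - m / l) *\<^sub>R J l f)) f"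
    by (simp add: g_def algebra_simps)
next
  fix f
  show "((\<lambda>l. norm (J l f - metric_proj C f)) \<longlongrightarrow> 0) (at_right 0)"
    by (rule resolvent_strong_limit[OF C A J])
next
  fix l :: real and f g
  assume "l \<ge> 0"
  then show "norm (J l f - J l g) \<le> norm (f - g)"
    using resolvent_nonexpansive[OF A(1) _ J] metric_proj_nonexpansive[OF C] J0
    by (cases "l = 0") auto
qed

theorem theorem3p5:
  fixes C :: "'a::{real_inner, complete_space} set"
    and J :: "real \<Rightarrow> 'a \<Rightarrow> 'a"
  assumes "C \<noteq> {}" and "closed C" and "convex C"
  shows "nonexpansive_resolvent_on J C \<longleftrightarrow>
    (\<exists>A. has_graph_limit (\<lambda>l. mv_of (\<lambda>f. (1 / l) *\<^sub>R (f - J l f))) A \<and>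
         mv_maximal_monotone A \<and>
         closure (mv_dom A) = C \<and>
         (\<forall>l>0. mv_of (J l) = mv_inverse (id_plus l A)) \<and>
         J 0 = metric_proj C)"
    (is "?L \<longleftrightarrow> ?R")
proof
  assume L: ?L
  then have "J 0 = metric_proj C" by (simp add: nonexpansive_resolvent_on_def)
  then show ?R
    using nonexpansive_resolvent_generator[OF assms L] has_graph_limit_yosida by blast
next
  assume ?R
  then show ?L
    using nonexpansive_resolvent_on_resolvents[OF assms]
    unfolding mv_maximal_monotone_def by blast
qed

end
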